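(* Let $n\ge1$ be an integer, let $L>0$, and let $s_1,\dots,s_{n+1}$ be pairwise different negative real numbers. Then the map $$F=(F_{s_i})_{i=1}^{n+1}\colon\mathcal D_n\cap[0,L]^2\to\mathbb R^{n(n+1)}$$ is continuous and injective, and hence a topological embedding.
   Context: $\mathcal D_1=T\cup\{\Delta\}$, where $T=\{(x_1,x_2)\in\mathbb R^2: x_2>x_1\ge0\}$ and $\Delta$ is one extra point (representing the diagonal). The metric $d_{\mathcal B}$ on $\mathcal D_1$ is given by $d_{\mathcal B}(\Delta,\Delta)=0$, $d_{\mathcal B}((x_1,x_2),\Delta)=|x_1-x_2|/2$, and $$d_{\mathcal B}((x_1,x_2),(y_1,y_2))=\min\Big\{\max\{|x_1-y_1|,|x_2-y_2|\},\ \max\{d_{\mathcal B}((x_1,x_2),\Delta),d_{\mathcal B}((y_1,y_2),\Delta)\}\Big\}.$$ $\mathcal D_n=\mathcal D_1^n/S_n$ is the set of unordered $n$-tuples (multisets) $[\bar x_1,\dots,\bar x_n]$ of points of $\mathcal D_1$, with the bottleneck metric $d_{\mathcal B}([\bar x_i],[\bar y_i])=\min_{\psi\in S_n}\max_i d_{\mathcal B}(\bar x_i,\bar y_{\psi(i)})$. $\mathcal D_n\cap[0,L]^2$ denotes the subspace of those diagrams in $\mathcal D_n$ each of whose points is either $\Delta$ or lies in $T\cap[0,L]^2$. For $s<0$ define $f_s\colon\mathcal D_1\cap[0,L]^2\to[\pi/4,\pi/2)$ by letting $f_s(x,y)=\arg\big((x,y)-(s,s)\big)$ be the angle of the vector $(x-s,y-s)$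 with the positive horizontal axis, for $(x,y)\in T\cap[0,L]^2$, and $f_s(\Delta)=\pi/4$. For $p\in\mathcal D_n\cap[0,L]^2$ let $F_s(p)\in[\pi/4,\pi/2)^n$ be the list of the $f_s$-values of the $n$ points of $p$ (with multiplicity, points equal to $\Delta$ included), ordered from the smallest to the largest. *)

theory Defs
  imports "HOL-Analysis.Analysis" "HOL-Combinatorics.Permutations" "HOL-Library.Multiset"
begin

datatype dpoint = Diag | Off real real

definition D1 :: "dpoint set" where
  "D1 = insert Diag {Off a b | a b. 0 \<le> a \<and> a < b}"

fun d1 :: "dpoint \<Rightarrow> dpoint \<Rightarrow> real" where
  "d1 Diag Diag = 0"
| "d1 (Off a b) Diag = \<bar>a - b\<bar> / 2"
| "d1 Diag (Off a b) = \<bar>a - b\<bar> / 2"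
| "d1 (Off a b) (Off a' b') =
     min (max \<bar>a - a'\<bar> \<bar>b - b'\<bar>) (max (\<bar>a - b\<bar> / 2) (\<bar>a' - b'\<bar> / 2))"

lemma d1_nonneg: "0 \<le> d1 x y"
  by (cases x; cases y) (auto simp: le_max_iff_disj)

lemma d1_commute: "d1 x y = d1 y x"
  by (cases x; cases y) (auto simp: abs_minus_commute max.commute)

lemma d1_zero: "x \<in> D1 \<Longrightarrow> y \<in> D1 \<Longrightarrow> d1 x y = 0 \<longleftrightarrow> x = y"
  by (cases x; cases y) (auto simp: D1_def min_def max_def split: if_splits)

lemma d1_triangle: "d1 x z \<le> d1 x y + d1 y z"
  by (cases x; cases y; cases z) (simp_all, (smt (verit) field_sum_of_halves)+)

lemma Metric_space_d1: "Metric_space D1 d1"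
  by unfold_locales (fact d1_nonneg d1_commute d1_zero | rule d1_triangle)+

definition Dn :: "nat \<Rightarrow> dpoint multiset set" where
  "Dn n = {p. size p = n \<and> set_mset p \<subseteq> D1}"

definition tuple_dist :: "nat \<Rightarrow> dpoint list \<Rightarrow> dpoint list \<Rightarrow> real" where
  "tuple_dist n xs ys =
     Min ((\<lambda>\<psi>. Max ((\<lambda>i. d1 (xs ! i) (ys ! \<psi> i)) ` {..<n})) ` {\<psi>. \<psi> permutes {..<n}})"

text \<open>The value does not depend on the chosen orderings, see \<open>bottleneck_mset\<close> below.
  The value 0 for multisets of the wrong size is only there because the locale
  \<^locale>\<open>Metric_space\<close> asks for nonnegativity and symmetry also outside the carrier.\<close>

definition bottleneck :: "nat \<Rightarrow> dpoint multiset \<Rightarrow> dpoint multiset \<Rightarrow> real" where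
  "bottleneck n p q =
     (if size p = n \<and> size q = n
      then tuple_dist n (SOME xs. mset xs = p) (SOME ys. mset ys = q) else 0)"

lemma tuple_dist_le_iff:
  assumes "n \<ge> 1"
  shows "tuple_dist n xs ys \<le> r \<longleftrightarrow>
    (\<exists>\<psi>. \<psi> permutes {..<n} \<and> (\<forall>i<n. d1 (xs ! i) (ys ! \<psi> i) \<le> r))"
proof -
  have ne: "{\<psi>. \<psi> permutes {..<n}} \<noteq> {}"
    using permutes_id by blast
  have "{..<n} \<noteq> {}" using assms by (auto simp: lessThan_empty_iff)
  then show ?thesis
    unfolding tuple_dist_def using ne
    by (subst Min_le_iff) (auto simp: finite_permutations)
qed

lemma tuple_dist_commute_le:
  assumes "n \<ge> 1"
  shows "tuple_dist n ys xs \<le> tuple_dist n xs ys"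
proof -
  obtain \<psi> where \<psi>: "\<psi> permutes {..<n}"
    "\<And>i. i < n \<Longrightarrow> d1 (xs ! i) (ys ! \<psi> i) \<le> tuple_dist n xs ys"
    using tuple_dist_le_iff[OF assms] by blast
  have "d1 (ys ! j) (xs ! inv \<psi> j) \<le> tuple_dist n xs ys" if "j < n" for j
    using \<psi>(2)[of "inv \<psi> j"] permutes_in_image[OF permutes_inv[OF \<psi>(1)], of j] that
      permutes_inverses(1)[OF \<psi>(1), of j] by (simp add: d1_commute)
  then show ?thesis
    using tuple_dist_le_iff[OF assms] permutes_inv[OF \<psi>(1)] by blast
qed

lemma tuple_dist_commute: "n \<ge> 1 \<Longrightarrow> tuple_dist n xs ys = tuple_dist n ys xs"
  by (intro antisym tuple_dist_commute_le)

lemma tuple_dist_mset_le: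
  assumes "n \<ge> 1" "length ys = n" "length ys' = n" "mset ys = mset ys'"
  shows "tuple_dist n xs ys' \<le> tuple_dist n xs ys"
proof -
  obtain \<pi> where \<pi>: "\<pi> permutes {..<n}" "permute_list \<pi> ys' = ys"
    using mset_eq_permutation[OF assms(4)] assms(3) by metis
  obtain \<psi> where \<psi>: "\<psi> permutes {..<n}"
    "\<And>i. i < n \<Longrightarrow> d1 (xs ! i) (ys ! \<psi> i) \<le> tuple_dist n xs ys"
    using tuple_dist_le_iff[OF assms(1)] by blast
  have "d1 (xs ! i) (ys' ! (\<pi> \<circ> \<psi>) i) \<le> tuple_dist n xs ys" if "i < n" for i
  proof -
    have "\<psi> i < n" using permutes_in_image[OF \<psi>(1), of i] that by simp
    then have "ys ! \<psi> i = ys' ! \<pi> (\<psi> i)"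
      using permute_list_nth[of \<pi> ys' "\<psi> i"] \<pi> assms(3) by auto
    then show ?thesis using \<psi>(2)[OF that] by simp
  qed
  then show ?thesis
    using tuple_dist_le_iff[OF assms(1)] permutes_compose[OF \<psi>(1) \<pi>(1)] by blast
qed

lemma tuple_dist_mset:
  assumes "n \<ge> 1" "length xs = n" "length ys = n" "mset xs' = mset xs" "mset ys' = mset ys"
  shows "tuple_dist n xs' ys' = tuple_dist n xs ys"
proof -
  have "length xs' = n" "length ys' = n"
    using assms mset_eq_length by metis+
  then show ?thesis
    using tuple_dist_mset_le tuple_dist_commute assms by (metis antisym)
qed

lemma bottleneck_mset:
  assumes "n \<ge> 1" "length xs = n" "length ys = n"
  shows "bottleneck n (mset xs) (mset ys) = tuple_dist n xs ys"
  unfolding bottleneck_def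
  using assms by (auto intro!: tuple_dist_mset intro: someI)

lemma Metric_space_bottleneck:
  assumes n: "n \<ge> 1"
  shows "Metric_space (Dn n) (bottleneck n)"
proof
  have td_nonneg: "0 \<le> tuple_dist n xs ys" for xs ys
  proof -
    obtain \<psi> where "\<forall>i<n. d1 (xs ! i) (ys ! \<psi> i) \<le> tuple_dist n xs ys"
      using tuple_dist_le_iff[OF n] by blast
    then show ?thesis
      using n d1_nonneg[of "xs ! 0" "ys ! \<psi> 0"] by (auto elim!: allE[of _ 0])
  qed
  show "0 \<le> bottleneck n p q" for p q
    by (simp add: bottleneck_def td_nonneg)
  show "bottleneck n p q = bottleneck n q p" for p q
    by (simp add: bottleneck_def tuple_dist_commute[OF n])
  have ex: "\<exists>xs. p = mset xs \<and> length xs = n \<and> set xs \<subseteq> D1" if "p \<in> Dn n" for p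
    using that ex_mset[of p] by (auto simp: Dn_def)
  show "bottleneck n p q = 0 \<longleftrightarrow> p = q" if pq: "p \<in> Dn n" "q \<in> Dn n" for p q
  proof -
    obtain xs ys where xs: "p = mset xs" "length xs = n" "set xs \<subseteq> D1"
      and ys: "q = mset ys" "length ys = n" "set ys \<subseteq> D1"
      using ex pq by meson
    have "bottleneck n p q = 0 \<longleftrightarrow> tuple_dist n xs ys \<le> 0"
      using bottleneck_mset[OF n xs(2) ys(2)] xs(1) ys(1) td_nonneg[of xs ys] by auto
    also have "\<dots> \<longleftrightarrow> (\<exists>\<psi>. \<psi> permutes {..<n} \<and> (\<forall>i<n. xs ! i = ys ! \<psi> i))"
    proof -
      have "d1 (xs ! i) (ys ! \<psi> i) \<le> 0 \<longleftrightarrow> xs ! i = ys ! \<psi> i"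
        if "\<psi> permutes {..<n}" "i < n" for \<psi> i
      proof -
        have "\<psi> i < n" using permutes_in_image[OF that(1), of i] that by simp
        then have "xs ! i \<in> D1" "ys ! \<psi> i \<in> D1"
          using xs ys that by (auto simp: subset_iff)
        then show ?thesis
          using d1_zero d1_nonneg by (metis order_antisym order_refl)
      qed
      then show ?thesis unfolding tuple_dist_le_iff[OF n] by blast
    qed
    also have "\<dots> \<longleftrightarrow> (\<exists>\<psi>. \<psi> permutes {..<n} \<and> permute_list \<psi> ys = xs)"
      using xs ys by (auto simp: list_eq_iff_nth_eq permute_list_nth)
    also have "\<dots> \<longleftrightarrow> p = q"
      using mset_eq_permutation[of xs ys] xs ys by (metis mset_permute_list)
    finally show ?thesis .
  qed
  show "bottleneck n p r \<le> bottleneck n p q + bottleneck n q r"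
    if pqr: "p \<in> Dn n" "q \<in> Dn n" "r \<in> Dn n" for p q r
  proof -
    obtain xs ys zs where xs: "p = mset xs" "length xs = n"
      and ys: "q = mset ys" "length ys = n" and zs: "r = mset zs" "length zs = n"
      using ex pqr by meson
    obtain \<psi> where \<psi>: "\<psi> permutes {..<n}"
      "\<And>i. i < n \<Longrightarrow> d1 (xs ! i) (ys ! \<psi> i) \<le> tuple_dist n xs ys"
      using tuple_dist_le_iff[OF n] by blast
    obtain \<phi> where \<phi>: "\<phi> permutes {..<n}"
      "\<And>i. i < n \<Longrightarrow> d1 (ys ! i) (zs ! \<phi> i) \<le> tuple_dist n ys zs"
      using tuple_dist_le_iff[OF n] by blast
    have "d1 (xs ! i) (zs ! (\<phi> \<circ> \<psi>) i) \<le> tuple_dist n xs ys + tuple_dist n ys zs"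
      if "i < n" for i
    proof -
      have "\<psi> i < n" using permutes_in_image[OF \<psi>(1), of i] that by simp
      from \<phi>(2)[OF this] \<psi>(2)[OF that] d1_triangle[of "xs ! i" "zs ! \<phi> (\<psi> i)" "ys ! \<psi> i"]
      show ?thesis by simp
    qed
    then have "tuple_dist n xs zs \<le> tuple_dist n xs ys + tuple_dist n ys zs"
      using tuple_dist_le_iff[OF n] permutes_compose[OF \<psi>(1) \<phi>(1)] by blast
    then show ?thesis
      using bottleneck_mset[OF n] xs ys zs by simp
  qed
qed

definition Dn_box :: "nat \<Rightarrow> real \<Rightarrow> dpoint multiset set" where
  "Dn_box n L = {p \<in> Dn n. \<forall>x \<in># p. x = Diag \<or> (\<exists>a\<in>{0..L}. \<exists>b\<in>{0..L}. x = Off a b)}"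

definition Dn_box_top :: "nat \<Rightarrow> real \<Rightarrow> dpoint multiset topology" where
  "Dn_box_top n L = subtopology (Metric_space.mtopology (Dn n) (bottleneck n)) (Dn_box n L)"

lemma topspace_Dn_box_top: "n \<ge> 1 \<Longrightarrow> topspace (Dn_box_top n L) = Dn_box n L"
  by (auto simp: Dn_box_top_def Dn_box_def
      Metric_space.topspace_mtopology[OF Metric_space_bottleneck])

fun f_ang :: "real \<Rightarrow> dpoint \<Rightarrow> real" where
  "f_ang s Diag = pi / 4"
| "f_ang s (Off x y) = Arg (Complex (x - s) (y - s))"

definition F_ang :: "real \<Rightarrow> dpoint multiset \<Rightarrow> real list" where
  "F_ang s p = sorted_list_of_multiset (image_mset (f_ang s) p)"

text \<open>The \<open>n + 1\<close> vectors \<open>F_ang (s 1) p, \<dots>, F_ang (s (n + 1)) p\<close> of length \<open>n\<close> are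
  concatenated; a point of the topology \<open>Euclidean_space m\<close> is a function on the naturals
  that vanishes from \<open>m\<close> on.\<close>

definition F_map :: "nat \<Rightarrow> (nat \<Rightarrow> real) \<Rightarrow> dpoint multiset \<Rightarrow> nat \<Rightarrow> real" where
  "F_map n s p =
     (\<lambda>k. if k < n * (n + 1) then F_ang (s (k div n + 1)) p ! (k mod n) else 0)"

end

theory Submission
  imports Defs
begin

text \<open>
  Injectivity is a pigeonhole argument. For \<open>s < 0\<close> the value \<open>f_ang s u\<close> determines the line that
  joins the centre \<open>(s, s)\<close> to \<open>u\<close>. Two different points have the same value for at most one such
  \<open>s\<close> (\<open>f_ang_separates\<close>). If two diagrams have the same images but are different, cancel their
  common points and take a remaining point \<open>u\<close> of one of them. For each of the \<open>n + 1\<close> centres the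
  other diagram has a remaining point \<open>v \<noteq> u\<close> with the same angle as \<open>u\<close>, and these points are
  pairwise different, which is impossible in a diagram of \<open>n\<close> points (\<open>image_f_ang_inj\<close>).

  For the topological part, the space of diagrams is seen as the image of the \<open>n\<close>-th power of the
  compact triangle \<open>0 \<le> a \<le> b \<le> L\<close> under the map that sends the diagonal to the extra point and
  forgets the order of the entries. This map is continuous (\<open>continuous_map_diagram_of\<close>), thus the
  space of diagrams is compact, and the map is a quotient map because it goes from a compact space
  onto a Hausdorff space. Continuity can therefore be tested on the power of the triangle, where
  estimates near the diagonal are no longer needed: there the angle is a continuous function of the
  coordinates, also on the diagonal, and sorting is continuous (\<open>continuous_map_nth_sort\<close>). Finally,
  a continuous injection of a compact space into a Hausdorff space is an embedding.
\<close>

section \<open>Lines through a point\<close>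

text \<open>Placing the extra point at the origin (any \<open>(r, r)\<close> with \<open>r \<ge> 0\<close> would do) turns its angle
  \<open>\<pi>/4\<close> into an ordinary argument, so that it needs no separate treatment below.\<close>

fun coords :: "dpoint \<Rightarrow> real \<times> real" where
  "coords Diag = (0, 0)"
| "coords (Off a b) = (a, b)"

lemma Arg_diagonal: "r > 0 \<Longrightarrow> Arg (Complex r r) = pi / 4"
proof -
  assume r: "r > 0"
  have "Complex r r = rcis (r * sqrt 2) (pi / 4)"
    by (auto simp: complex_eq_iff cos_45 sin_45)
  then show ?thesis
    using r by (simp add: Arg_rcis del: rcis_def)
qed

lemma f_ang_coords: "s < 0 \<Longrightarrow> f_ang s u = Arg (Complex (fst (coords u) - s) (snd (coords u) - s))"
  by (cases u) (simp_all add: Arg_diagonal)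

lemma Arg_eq_imp_cross:
  assumes "Arg w = Arg z" "w \<noteq> 0" "z \<noteq> 0"
  shows "Re w * Im z = Im w * Re z"
proof -
  obtain x where "w = of_real x * z"
    using assms Arg_eq_iff by blast
  then show ?thesis by simp
qed

text \<open>Equality of the angles seen from \<open>(s, s)\<close> says that the two points are collinear with
  \<open>(s, s)\<close>, which is an affine equation in \<open>s\<close>. If it has two solutions, then the line through the
  two points meets the diagonal twice and is the diagonal; the only point of \<open>D1\<close> there is the
  extra one.\<close>

lemma f_ang_separates:
  assumes "u \<in> D1" "v \<in> D1" "s < 0" "t < 0" "s \<noteq> t"
    and "f_ang s u = f_ang s v" "f_ang t u = f_ang t v"
  shows "u = v"
proof -
  obtain a b where ab: "coords u = (a, b)" by fastforce
  obtain c d where cd: "coords v = (c, d)" by fastforce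
  have nn: "0 \<le> a" "0 \<le> c"
    using assms(1,2) ab cd by (cases u; cases v; auto simp: D1_def)+
  have cross: "(a - r) * (d - r) = (b - r) * (c - r)" if "r < 0" "f_ang r u = f_ang r v" for r
    using Arg_eq_imp_cross[of "Complex (a - r) (b - r)" "Complex (c - r) (d - r)"]
      that nn by (auto simp: f_ang_coords ab cd complex_eq_iff)
  have eqs: "a * d - b * c = s * (a + d - b - c)" "a * d - b * c = t * (a + d - b - c)"
    using cross[of s] cross[of t] assms by (simp_all add: algebra_simps)
  then have "(s - t) * (a + d - b - c) = 0" by (simp add: algebra_simps)
  then have gap: "b - a = d - c" using assms(5) by simp
  then have "a * d - b * c = 0" using eqs(1) by simp
  moreover have "a * d - b * c = (b - a) * (a - c)"
    using gap by algebra
  ultimately have "b = a \<or> a = c" by simp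
  then show ?thesis
    using gap ab cd assms(1,2) by (cases u; cases v) (auto simp: D1_def)
qed

text \<open>After cancelling the common part, a point \<open>u\<close> of one multiset is joined to each
  centre \<open>(s, s)\<close> by a line that contains a point of the other multiset. By \<open>f_ang_separates\<close> these
  points are pairwise different, so the other multiset has at least \<open>card S\<close> elements.\<close>

lemma image_f_ang_inj:
  assumes "finite S" "\<forall>s\<in>S. s < 0"
    and "set_mset p \<subseteq> D1" "set_mset q \<subseteq> D1" "size q < card S"
    and eq: "\<forall>s\<in>S. image_mset (f_ang s) p = image_mset (f_ang s) q"
  shows "p = q"
proof -
  define p' q' where "p' = p - q" and "q' = q - p"
  have split: "p = p' + p \<inter># q" "q = q' + p \<inter># q"
    by (auto simp: p'_def q'_def multiset_eq_iff)
  have sub: "set_mset p' \<subseteq> D1" "set_mset q' \<subseteq> D1"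
    using assms(3,4) in_diffD by (fastforce simp: p'_def q'_def)+
  have eq': "image_mset (f_ang s) p' = image_mset (f_ang s) q'" if "s \<in> S" for s
    using eq that split by (metis add_right_cancel image_mset_union)
  have disj: "u \<notin># q'" if "u \<in># p'" for u
    using that by (auto simp: p'_def q'_def in_diff_count)
  have "p' = {#}"
  proof (rule ccontr)
    assume "p' \<noteq> {#}"
    then obtain u where u: "u \<in># p'" by blast
    have "\<exists>v. v \<in># q' \<and> f_ang s u = f_ang s v" if "s \<in> S" for s
    proof -
      have "f_ang s u \<in># image_mset (f_ang s) q'"
        using u eq'[OF that] by (metis image_eqI set_image_mset)
      then show ?thesis by auto
    qed
    then obtain v where v: "\<And>s. s \<in> S \<Longrightarrow> v s \<in># q' \<and> f_ang s u = f_ang s (v s)"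
      by metis
    have "inj_on v S"
    proof (rule inj_onI, rule ccontr)
      fix s t assume st: "s \<in> S" "t \<in> S" "v s = v t" "s \<noteq> t"
      then have "u = v s"
        using f_ang_separates[of u "v s" s t] v[of s] v[of t] u sub assms(2) by auto
      then show False using disj[OF u] v[OF st(1)] by simp
    qed
    then have "card S \<le> card (set_mset q')"
      by (rule card_inj_on_le) (use v in auto)
    also have "\<dots> \<le> size q'"
      using size_multiset_overloaded_eq[of q'] sum_mono[of "set_mset q'" "\<lambda>_. 1" "count q'"]
      by (auto simp: Suc_le_eq)
    also have "\<dots> \<le> size q"
      unfolding q'_def by (simp add: size_mset_mono)
    finally show False using assms(5) by simp
  qed
  moreover from this have "q' = {#}"
    using eq' assms(5) by (metis all_not_in_conv card.empty image_mset_is_empty_iff not_less0)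
  ultimately show ?thesis using split by simp
qed

lemma F_map_inj:
  assumes "n \<ge> 1" "inj_on s {1..n + 1}" "\<And>i. i \<in> {1..n + 1} \<Longrightarrow> s i < 0"
  shows "inj_on (F_map n s) (Dn n)"
proof (rule inj_onI)
  fix p q assume p: "p \<in> Dn n" and q: "q \<in> Dn n" and eq: "F_map n s p = F_map n s q"
  have len: "length (F_ang r p) = n" "length (F_ang r q) = n" for r
    using p q by (simp_all add: F_ang_def Dn_def flip: size_mset)
  have "F_ang (s i) p = F_ang (s i) q" if i: "i \<in> {1..n + 1}" for i
  proof (rule nth_equalityI)
    fix k assume "k < length (F_ang (s i) p)"
    then have k: "k < n" by (simp add: len)
    \<comment> \<open>\<open>j\<close> is the position of entry \<open>k\<close> of block \<open>i\<close>; blocks are counted from 1.\<close>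
    define j where "j = (i - 1) * n + k"
    have "j < (i - 1) * n + n" using k by (simp add: j_def)
    also have "\<dots> = i * n" using i by (cases i) auto
    also have "\<dots> \<le> n * (n + 1)" using i by (metis atLeastAtMost_iff mult.commute mult_le_mono1)
    finally have "j < n * (n + 1)" .
    moreover have "j div n + 1 = i" "j mod n = k"
      using k i by (auto simp: j_def)
    ultimately show "F_ang (s i) p ! k = F_ang (s i) q ! k"
      using fun_cong[OF eq, of j] by (simp add: F_map_def)
  qed (simp add: len)
  then have "image_mset (f_ang r) p = image_mset (f_ang r) q" if "r \<in> s ` {1..n + 1}" for r
    using that unfolding F_ang_def by (metis (no_types, lifting) imageE mset_sorted_list_of_multiset)
  then show "p = q"
    using p q assms by (intro image_f_ang_inj[of "s ` {1..n + 1}"]) (auto simp: Dn_def card_image)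
qed

section \<open>Order statistics of continuous functions\<close>

text \<open>A down-closed predicate holds exactly on an initial segment of a sorted list, and the length
  of that segment can be read off the unsorted list.\<close>

lemma nth_sort_iff:
  fixes xs :: "'a::linorder list"
  assumes k: "k < length xs" and down: "\<And>x y. x \<le> y \<Longrightarrow> P y \<Longrightarrow> P x"
  shows "P (sort xs ! k) \<longleftrightarrow> k < card {i. i < length xs \<and> P (xs ! i)}"
proof -
  let ?A = "{i. i < length xs \<and> P (sort xs ! i)}"
  have "length (filter P (sort xs)) = length (filter P xs)"
    by (metis mset_filter mset_sort size_mset)
  then have card: "card {i. i < length xs \<and> P (xs ! i)} = card ?A"
    by (simp add: length_filter_conv_card)
  have mono: "sort xs ! i \<le> sort xs ! j" if "i \<le> j" "j < length xs" for i j
    using that by (simp add: sorted_nth_mono)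
  show ?thesis
  proof
    assume P: "P (sort xs ! k)"
    have "{..k} \<subseteq> ?A" using down[OF mono P] k by auto
    then have "card {..k} \<le> card ?A" by (intro card_mono) auto
    then show "k < card {i. i < length xs \<and> P (xs ! i)}" by (simp add: card)
  next
    assume *: "k < card {i. i < length xs \<and> P (xs ! i)}"
    show "P (sort xs ! k)"
    proof (rule ccontr)
      assume "\<not> P (sort xs ! k)"
      then have "?A \<subseteq> {..<k}"
        using down[OF mono] by (metis (mono_tags, lifting) lessThan_iff mem_Collect_eq not_le subsetI)
      then have "card ?A \<le> card {..<k}" by (intro card_mono) auto
      then show False using * card by simp
    qed
  qed
qed

text \<open>The set is the union, over the finitely many \<open>J \<subseteq> I\<close> with at least \<open>m\<close> elements, of finite
  intersections of open sets.\<close>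

lemma openin_card_ge:
  assumes "finite I" "\<And>i. i \<in> I \<Longrightarrow> openin X {x \<in> topspace X. Q i x}"
  shows "openin X {x \<in> topspace X. m \<le> card {i \<in> I. Q i x}}"
proof -
  have "{x \<in> topspace X. m \<le> card {i \<in> I. Q i x}} =
        (\<Union>J\<in>{J. J \<subseteq> I \<and> m \<le> card J}. {x \<in> topspace X. \<forall>i\<in>J. Q i x})"
  proof (intro equalityI subsetI)
    fix x assume "x \<in> {x \<in> topspace X. m \<le> card {i \<in> I. Q i x}}"
    then show "x \<in> (\<Union>J\<in>{J. J \<subseteq> I \<and> m \<le> card J}. {x \<in> topspace X. \<forall>i\<in>J. Q i x})"
      by (intro UN_I[of "{i \<in> I. Q i x}"]) auto
  next
    fix x assume "x \<in> (\<Union>J\<in>{J. J \<subseteq> I \<and> m \<le> card J}. {x \<in> topspace X. \<forall>i\<in>J. Q i x})"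
    then obtain J where J: "J \<subseteq> I" "m \<le> card J" "x \<in> topspace X" "\<forall>i\<in>J. Q i x" by blast
    then have "card J \<le> card {i \<in> I. Q i x}"
      using assms(1) by (intro card_mono) auto
    then show "x \<in> {x \<in> topspace X. m \<le> card {i \<in> I. Q i x}}" using J by auto
  qed
  moreover have "openin X {x \<in> topspace X. \<forall>i\<in>J. Q i x}" if "J \<subseteq> I" for J
  proof -
    have "finite J" using that assms(1) finite_subset by blast
    then show ?thesis
      using that
    proof (induction J)
      case (insert i J)
      have "{x \<in> topspace X. \<forall>i\<in>insert i J. Q i x} =
            {x \<in> topspace X. Q i x} \<inter> {x \<in> topspace X. \<forall>i\<in>J. Q i x}" by auto
      then show ?case using insert assms(2) by auto
    qed simp
  qed
  ultimately show ?thesis by (auto intro!: openin_Union)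
qed

text \<open>The \<open>k\<close>-th smallest value is below \<open>a\<close> iff more than \<open>k\<close> of the values are, and above \<open>a\<close> iff
  at least \<open>n - k\<close> are; both are open conditions.\<close>

lemma continuous_map_nth_sort:
  fixes g :: "nat \<Rightarrow> 'a \<Rightarrow> real"
  assumes k: "k < n" and g: "\<And>i. i < n \<Longrightarrow> continuous_map X euclideanreal (g i)"
  shows "continuous_map X euclideanreal (\<lambda>x. sort (map (\<lambda>i. g i x) [0..<n]) ! k)"
proof -
  let ?h = "\<lambda>x. sort (map (\<lambda>i. g i x) [0..<n]) ! k"
  have g_open: "openin X {x \<in> topspace X. a < g i x}" "openin X {x \<in> topspace X. g i x < a}"
    if "i \<in> {..<n}" for i a
    using g[of i] that unfolding continuous_map_upper_lower_semicontinuous_lt by auto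
  have low: "?h x < a \<longleftrightarrow> Suc k \<le> card {i \<in> {..<n}. g i x < a}" for x a
    using nth_sort_iff[of k "map (\<lambda>i. g i x) [0..<n]" "\<lambda>y. y < a"] k
    by (auto simp: Suc_le_eq cong: conj_cong)
  have high: "a < ?h x \<longleftrightarrow> n - k \<le> card {i \<in> {..<n}. a < g i x}" for x a
  proof -
    have "?h x \<le> a \<longleftrightarrow> k < card {i \<in> {..<n}. g i x \<le> a}"
      using nth_sort_iff[of k "map (\<lambda>i. g i x) [0..<n]" "\<lambda>y. y \<le> a"] k
      by (auto cong: conj_cong)
    moreover have "card {i \<in> {..<n}. g i x \<le> a} + card {i \<in> {..<n}. a < g i x} = n"
    proof -
      have "{i \<in> {..<n}. g i x \<le> a} \<union> {i \<in> {..<n}. a < g i x} = {..<n}" by auto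
      moreover have "{i \<in> {..<n}. g i x \<le> a} \<inter> {i \<in> {..<n}. a < g i x} = {}" by auto
      ultimately show ?thesis
        by (metis (no_types, lifting) card_Un_disjoint card_lessThan finite_Un finite_lessThan)
    qed
    ultimately show ?thesis using k by auto
  qed
  show ?thesis
    unfolding continuous_map_upper_lower_semicontinuous_lt low high
    using g_open by (intro conjI allI openin_card_ge) simp_all
qed

section \<open>The space of diagrams as a quotient of a power of a triangle\<close>

definition closed_triangle :: "real \<Rightarrow> (real \<times> real) set" where
  "closed_triangle L = {(a, b). 0 \<le> a \<and> a \<le> b \<and> b \<le> L}"

definition point_of :: "real \<times> real \<Rightarrow> dpoint" where
  "point_of z = (if fst z < snd z then Off (fst z) (snd z) else Diag)"

definition diagram_of :: "nat \<Rightarrow> (nat \<Rightarrow> real \<times> real) \<Rightarrow> dpoint multiset" where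
  "diagram_of n x = mset (map (\<lambda>i. point_of (x i)) [0..<n])"

definition triangle_power :: "real \<Rightarrow> nat \<Rightarrow> (nat \<Rightarrow> real \<times> real) topology" where
  "triangle_power L n = product_topology (\<lambda>_. top_of_set (closed_triangle L)) {..<n}"

lemma compact_closed_triangle: "compact (closed_triangle L)"
proof -
  have "closed_triangle L = cbox (0, 0) (L, L) \<inter> {z. fst z \<le> snd z}"
    by (auto simp: closed_triangle_def cbox_Pair_eq)
  moreover have "closed {z :: real \<times> real. fst z \<le> snd z}"
    by (intro closed_Collect_le continuous_intros)
  ultimately show ?thesis by auto
qed

lemma compact_space_triangle_power: "compact_space (triangle_power L n)"
  by (simp add: triangle_power_def compact_space_product_topology compact_space_subtopology
      compact_closed_triangle)

lemma topspace_triangle_power: "topspace (triangle_power L n) = {..<n} \<rightarrow>\<^sub>E closed_triangle L"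
  by (simp add: triangle_power_def)

text \<open>The point \<open>(a, b)\<close> has distance \<open>\<bar>a - b\<bar> / 2\<close> from the diagonal in the maximum norm, which
  the Euclidean norm dominates; so collapsing the diagonal to a point does not increase
  distances.\<close>

lemma d1_point_of_le:
  assumes "z \<in> closed_triangle L" "w \<in> closed_triangle L"
  shows "d1 (point_of z) (point_of w) \<le> dist z w"
proof -
  have "\<bar>fst z - fst w\<bar> \<le> dist z w" "\<bar>snd z - snd w\<bar> \<le> dist z w"
    using dist_fst_le[of z w] dist_snd_le[of z w] by (simp_all add: dist_real_def)
  then show ?thesis
    using assms by (auto simp: point_of_def closed_triangle_def min_le_iff_disj)
qed

lemma diagram_of_image:
  assumes "0 \<le> L"
  shows "diagram_of n ` topspace (triangle_power L n) = Dn_box n L"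
proof (intro equalityI subsetI)
  fix p assume "p \<in> diagram_of n ` topspace (triangle_power L n)"
  then obtain x where x: "p = diagram_of n x" "\<And>i. i < n \<Longrightarrow> x i \<in> closed_triangle L"
    by (auto simp: topspace_triangle_power)
  have "point_of z \<in> D1 \<and> (point_of z = Diag \<or> (\<exists>a\<in>{0..L}. \<exists>b\<in>{0..L}. point_of z = Off a b))"
    if "z \<in> closed_triangle L" for z
    using that by (auto simp: point_of_def closed_triangle_def D1_def)
  then have "\<forall>i<n. point_of (x i) \<in> D1 \<and>
      (point_of (x i) = Diag \<or> (\<exists>a\<in>{0..L}. \<exists>b\<in>{0..L}. point_of (x i) = Off a b))"
    using x(2) by blast
  then show "p \<in> Dn_box n L"
    unfolding x(1) by (auto simp: Dn_box_def Dn_def diagram_of_def)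
next
  fix p assume p: "p \<in> Dn_box n L"
  obtain us where us: "mset us = p" using ex_mset by blast
  have len: "length us = n" using us p by (auto simp: Dn_box_def Dn_def)
  \<comment> \<open>\<open>coords\<close> lifts the extra point to the corner \<open>(0, 0)\<close> of the triangle.\<close>
  define x where "x = (\<lambda>i\<in>{..<n}. coords (us ! i))"
  have *: "coords u \<in> closed_triangle L \<and> point_of (coords u) = u" if "u \<in># p" for u
    using that p assms by (cases u) (fastforce simp: Dn_box_def Dn_def D1_def closed_triangle_def point_of_def)+
  have mem: "us ! i \<in># p" if "i < n" for i
    using that us len nth_mem by fastforce
  have "x \<in> topspace (triangle_power L n)"
    using * mem by (auto simp: x_def topspace_triangle_power)
  moreover have "map (\<lambda>i. point_of (x i)) [0..<n] = us"
    using * mem len by (intro nth_equalityI) (auto simp: x_def)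
  then have "diagram_of n x = p"
    by (simp add: diagram_of_def us)
  ultimately show "p \<in> diagram_of n ` topspace (triangle_power L n)" by blast
qed

lemma continuous_map_diagram_of:
  assumes n: "n \<ge> 1" and L: "0 \<le> L"
  shows "continuous_map (triangle_power L n) (Dn_box_top n L) (diagram_of n)"
proof -
  interpret Metric_space "Dn n" "bottleneck n" by (rule Metric_space_bottleneck[OF n])
  have box: "diagram_of n x \<in> Dn_box n L" if "x \<in> topspace (triangle_power L n)" for x
    using diagram_of_image[OF L] that by blast
  have carrier: "diagram_of n x \<in> Dn n" if "x \<in> topspace (triangle_power L n)" for x
    using box[OF that] by (simp add: Dn_box_def)
  have "continuous_map (triangle_power L n) mtopology (diagram_of n)"
    unfolding continuous_map_to_metric
  proof (intro ballI allI impI)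
    fix x and e :: real assume x: "x \<in> topspace (triangle_power L n)" and e: "0 < e"
    define U where "U = (\<Pi>\<^sub>E i\<in>{..<n}. closed_triangle L \<inter> ball (x i) (e / 2))"
    have "openin (triangle_power L n) U"
      by (auto simp: U_def triangle_power_def openin_PiE openin_open_Int)
    moreover have "x \<in> U"
      using x e by (auto simp: U_def topspace_triangle_power PiE_iff)
    moreover have "diagram_of n y \<in> mball (diagram_of n x) e" if y: "y \<in> U" for y
    proof -
      have y': "y \<in> topspace (triangle_power L n)"
        using y by (auto simp: U_def topspace_triangle_power PiE_iff)
      have "d1 (point_of (x i)) (point_of (y i)) \<le> e / 2" if "i < n" for i
      proof -
        have "x i \<in> closed_triangle L" "y i \<in> closed_triangle L" "dist (x i) (y i) < e / 2"
          using x y that by (auto simp: U_def topspace_triangle_power PiE_iff)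
        then show ?thesis
          using d1_point_of_le by fastforce
      qed
      then have "bottleneck n (diagram_of n x) (diagram_of n y) \<le> e / 2"
        unfolding diagram_of_def
        by (subst bottleneck_mset[OF n], simp, simp, subst tuple_dist_le_iff[OF n],
            intro exI[of _ id]) (simp add: permutes_id)
      then show ?thesis
        using e carrier x y' by simp
    qed
    ultimately show "\<exists>U. openin (triangle_power L n) U \<and> x \<in> U \<and>
        (\<forall>y\<in>U. diagram_of n y \<in> mball (diagram_of n x) e)"
      by blast
  qed
  then show ?thesis
    using box by (auto simp: Dn_box_top_def continuous_map_in_subtopology)
qed

lemma compact_space_Dn_box_top:
  assumes "n \<ge> 1" "0 \<le> L"
  shows "compact_space (Dn_box_top n L)"
proof -
  have "compactin (Dn_box_top n L) (diagram_of n ` topspace (triangle_power L n))"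
    using image_compactin[OF _ continuous_map_diagram_of[OF assms]] compact_space_triangle_power
    by (auto simp: compact_space_def)
  then show ?thesis
    by (simp add: compact_space_def diagram_of_image[OF assms(2)] topspace_Dn_box_top[OF assms(1)])
qed

lemma quotient_map_diagram_of:
  assumes "n \<ge> 1" "0 \<le> L"
  shows "quotient_map (triangle_power L n) (Dn_box_top n L) (diagram_of n)"
proof (rule continuous_imp_quotient_map)
  show "Hausdorff_space (Dn_box_top n L)"
    unfolding Dn_box_top_def
    by (intro Hausdorff_space_subtopology Metric_space.Hausdorff_space_mtopology
        Metric_space_bottleneck assms)
qed (simp_all add: continuous_map_diagram_of[OF assms] compact_space_triangle_power
    diagram_of_image[OF assms(2)] topspace_Dn_box_top[OF assms(1)])

section \<open>Continuity of the angle vectors\<close>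

lemma f_ang_point_of:
  assumes "z \<in> closed_triangle L" "s < 0"
  shows "f_ang s (point_of z) = Arg (Complex (fst z - s) (snd z - s))"
  using assms by (auto simp: point_of_def closed_triangle_def Arg_diagonal)

lemma continuous_on_f_ang_point_of:
  assumes "s < 0"
  shows "continuous_on (closed_triangle L) (\<lambda>z. f_ang s (point_of z))"
proof -
  have "continuous_on (closed_triangle L) (\<lambda>z. Arg (Complex (fst z - s) (snd z - s)))"
    using assms
    by (intro continuous_on_Arg' continuous_intros) (auto simp: closed_triangle_def complex_nonpos_Reals_iff)
  then show ?thesis
    by (rule continuous_on_eq) (simp add: f_ang_point_of assms)
qed

lemma continuous_map_F_ang_diagram_of:
  assumes "s < 0" "k < n"
  shows "continuous_map (triangle_power L n) euclideanreal (\<lambda>x. F_ang s (diagram_of n x) ! k)"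
proof -
  have "continuous_map (triangle_power L n) euclideanreal (\<lambda>x. f_ang s (point_of (x i)))"
    if "i < n" for i
  proof -
    have "continuous_map (triangle_power L n) (top_of_set (closed_triangle L)) (\<lambda>x. x i)"
      using continuous_map_product_projection[of i "{..<n}" "\<lambda>_. top_of_set (closed_triangle L)"] that
      by (simp add: triangle_power_def)
    moreover have "continuous_map (top_of_set (closed_triangle L)) euclideanreal (\<lambda>z. f_ang s (point_of z))"
      using continuous_on_f_ang_point_of[OF assms(1)] by simp
    ultimately show ?thesis
      using continuous_map_compose[of _ _ "\<lambda>x. x i" _ "\<lambda>z. f_ang s (point_of z)"]
      by (simp add: o_def)
  qed
  moreover have "F_ang s (diagram_of n x) = sort (map (\<lambda>i. f_ang s (point_of (x i))) [0..<n])" for x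
    by (simp add: F_ang_def diagram_of_def o_def flip: mset_map)
  ultimately show ?thesis
    using continuous_map_nth_sort[OF assms(2), of _ "\<lambda>i x. f_ang s (point_of (x i))"] by simp
qed

lemma continuous_map_F_map:
  assumes "n \<ge> 1" "0 \<le> L" "\<And>i. i \<in> {1..n + 1} \<Longrightarrow> s i < 0"
  shows "continuous_map (Dn_box_top n L) (Euclidean_space (n * (n + 1))) (F_map n s)"
proof -
  have "continuous_map (triangle_power L n) euclideanreal (\<lambda>x. F_map n s (diagram_of n x) k)" for k
  proof (cases "k < n * (n + 1)")
    case True
    then have "k div n < n + 1" by (simp add: less_mult_imp_div_less mult.commute)
    then have "s (k div n + 1) < 0" by (intro assms(3)) simp
    then show ?thesis
      using continuous_map_F_ang_diagram_of[of "s (k div n + 1)" "k mod n" n L] assms(1) True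
      by (simp add: F_map_def)
  qed (simp add: F_map_def)
  then have "continuous_map (triangle_power L n) (Euclidean_space (n * (n + 1)))
      (F_map n s \<circ> diagram_of n)"
    by (auto simp: Euclidean_space_def continuous_map_in_subtopology continuous_map_componentwise_UNIV
        F_map_def)
  then show ?thesis
    using continuous_compose_quotient_map quotient_map_diagram_of assms(1,2) by blast
qed

theorem mainTheorem4:
  fixes n :: nat and L :: real and s :: "nat \<Rightarrow> real"
  assumes "n \<ge> 1"
    and "L > 0"
    and "inj_on s {1..n + 1}"
    and "\<And>i. i \<in> {1..n + 1} \<Longrightarrow> s i < 0"
  shows "continuous_map (Dn_box_top n L) (Euclidean_space (n * (n + 1))) (F_map n s)
       \<and> inj_on (F_map n s) (Dn_box n L)
       \<and> embedding_map (Dn_box_top n L) (Euclidean_space (n * (n + 1))) (F_map n s)"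
proof (intro conjI)
  show cont: "continuous_map (Dn_box_top n L) (Euclidean_space (n * (n + 1))) (F_map n s)"
    using assms by (intro continuous_map_F_map) auto
  show inj: "inj_on (F_map n s) (Dn_box n L)"
    using assms by (intro inj_on_subset[OF F_map_inj]) (auto simp: Dn_box_def)
  show "embedding_map (Dn_box_top n L) (Euclidean_space (n * (n + 1))) (F_map n s)"
    using cont inj assms
    by (intro continuous_imp_embedding_map compact_space_Dn_box_top Hausdorff_Euclidean_space)
      (auto simp: topspace_Dn_box_top)
qed

end
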